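(* Let $h\ge 2$ be an even integer and $M=4h$. For $\alpha\in(\mathbb Z/2h\mathbb Z)^\times$ let $b_\alpha$, $\mathcal F$, $\alpha^\vee$ and $C_\alpha$ be as defined in the context. Then: (i) The constant $C_\alpha$ is independent of all chosen representatives ($u$ and $U$), and it is intrinsically given by $C_\alpha=(\mathcal F b_\alpha)(1)$. (ii) For every $\alpha\in(\mathbb Z/2h\mathbb Z)^\times$, $$\mathcal F b_\alpha=C_\alpha\, b_{\alpha^\vee}.$$ (iii) For every $\alpha\in(\mathbb Z/2h\mathbb Z)^\times$, $$(\alpha^\vee)^\vee=\alpha,\qquad (\alpha+h)^\vee=\alpha^\vee+h,\qquad C_{\alpha+h}=C_\alpha .$$ (iv) For every $\alpha\in(\mathbb Z/2h\mathbb Z)^\times$, $$|C_\alpha|=\sqrt M=2\sqrt h,\qquad C_\alpha C_{\alpha^\vee}=M .$$ (v) Consequently, $u\mapsto -u^{-1}$ is a well-defined involution on $(\mathbb Z/h\mathbb Z)^\times$, and the identity in (ii) descends to that parameter space: $b_\alpha$ and $C_\alpha$ depend only on the image $u$ of $\alpha$ in $(\mathbb Z/h\mathbb Z)^\times$, the image of $\alpha^\vee$ is $-u^{-1}$, and, writing $b_{h,u}:=b_\alpha$ and $\gamma_h(u):=C_\alpha$ for either lift $\alpha$ of $u$, one has $\mathcal F b_{h,u}=\gamma_h(u)\,b_{h,-u^{-1}}$ for every $u\in(\mathbb Z/h\mathbb Z)^\times$.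
   Context: Write $e(x)=e^{2\pi i x}$ and $T_k=k(k+1)/2$. Let $h\ge2$ be even and $M=4h$. For $\alpha\in(\mathbb Z/2h\mathbb Z)^\times$ and an odd integer $u$ representing $\alpha$, $b_\alpha:\mathbb Z\to\mathbb C$ is the $M$-periodic function $$b_\alpha(2k+1):=e\left(\frac{uT_k}{h}\right),\qquad b_\alpha(2k):=0\qquad(k\in\mathbb Z);$$ it does not depend on the representative $u$, and $b_{\alpha+h}=b_\alpha$. The unnormalized Fourier transform of an $M$-periodic function $f$ is $$(\mathcal F f)(r):=\sum_{m\bmod M}f(m)\,e\left(\frac{mr}{M}\right).$$ The dual parameter is $\alpha^\vee:=-\alpha^{-1}$ in $(\mathbb Z/2h\mathbb Z)^\times$. For an odd representative $u$ of $\alpha$, an integer $U$ with $Uu\equiv1\pmod{2h}$, and $d=(u+1)/2$, put $$G(u;2h):=\sum_{k\bmod 2h}e\left(\frac{uk^2}{2h}\right),\qquad C_\alpha:=e\left(\frac1{4h}-\frac{Ud^2}{2h}\right)G(u;2h).$$ *)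

theory Defs
  imports Complex_Main "HOL-Number_Theory.Residues"
begin

text \<open>
  The ring \<open>\<int>/n\<int>\<close> is \<^const>\<open>residue_ring\<close> \<open>n\<close>, whose carrier is \<open>{0..n-1}\<close>; the
  reduction map from \<open>\<int>\<close> (or from \<open>\<int>/2n\<int>\<close>) to it is \<open>\<lambda>x. x mod n\<close>.
\<close>

definition expi :: "real \<Rightarrow> complex" where
  "expi x = exp (2 * of_real pi * \<i> * of_real x)"

definition tri :: "int \<Rightarrow> int" where
  "tri k = k * (k + 1) div 2"

text \<open>
  \<open>b_seq h u\<close> is the function \<open>b\<^sub>\<alpha>\<close> computed from the integer representative \<open>u\<close> of \<open>\<alpha>\<close>.
  By \<open>b_seq_cong\<close> below it depends only on \<open>u\<close> modulo \<open>h\<close>, so for \<open>\<alpha>\<close> in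
  \<open>Units (residue_ring (2 * h))\<close> we write \<open>b_seq h \<alpha>\<close>, using \<open>\<alpha>\<close> itself
  as a representative.
\<close>

definition b_seq :: "int \<Rightarrow> int \<Rightarrow> int \<Rightarrow> complex" where
  "b_seq h u n =
     (if odd n then expi (of_int (u * tri ((n - 1) div 2)) / of_int h) else 0)"

definition fourier :: "int \<Rightarrow> (int \<Rightarrow> complex) \<Rightarrow> int \<Rightarrow> complex" where
  "fourier M f r = (\<Sum>m\<in>{0..<M}. f m * expi (of_int (m * r) / of_int M))"

definition neg_inv :: "int \<Rightarrow> int \<Rightarrow> int" where
  "neg_inv n a = \<ominus>\<^bsub>residue_ring n\<^esub> (inv\<^bsub>residue_ring n\<^esub> a)"

definition gauss_sum :: "int \<Rightarrow> int \<Rightarrow> complex" where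
  "gauss_sum u n = (\<Sum>k\<in>{0..<n}. expi (of_int (u * k\<^sup>2) / of_int n))"

text \<open>
  \<open>C_rep h u U\<close> is \<open>C\<^sub>\<alpha>\<close> computed from an odd representative \<open>u\<close> of \<open>\<alpha>\<close> and an inverse
  \<open>U\<close> of \<open>u\<close> modulo \<open>2h\<close>; \<open>C_const h \<alpha>\<close> uses the representatives in \<open>{0..2h-1}\<close>.
\<close>

definition C_rep :: "int \<Rightarrow> int \<Rightarrow> int \<Rightarrow> complex" where
  "C_rep h u U =
     (let d = (u + 1) div 2
      in expi (1 / (4 * of_int h) - of_int (U * d\<^sup>2) / (2 * of_int h)) * gauss_sum u (2 * h))"

definition C_const :: "int \<Rightarrow> int \<Rightarrow> complex" where
  "C_const h \<alpha> = C_rep h \<alpha> (inv\<^bsub>residue_ring (2 * h)\<^esub> \<alpha>)"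

definition lifts :: "int \<Rightarrow> int \<Rightarrow> int set" where
  "lifts h u = {\<alpha> \<in> Units (residue_ring (2 * h)). \<alpha> mod h = u}"

definition b_desc :: "int \<Rightarrow> int \<Rightarrow> int \<Rightarrow> complex" where
  "b_desc h u = b_seq h (SOME \<alpha>. \<alpha> \<in> lifts h u)"

definition gamma_desc :: "int \<Rightarrow> int \<Rightarrow> complex" where
  "gamma_desc h u = C_const h (SOME \<alpha>. \<alpha> \<in> lifts h u)"

lemma expi_add_int: "expi (x + of_int n) = expi x"
proof -
  have "expi (x + of_int n) = expi x * exp (2 * of_int n * of_real pi * \<i>)"
    by (simp add: expi_def algebra_simps flip: exp_add)
  also have "exp (2 * of_int n * of_real pi * \<i>) = cis (2 * pi * of_int n)"
    by (simp add: cis_conv_exp mult_ac)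
  also have "\<dots> = 1"
    by (intro cis_multiple_2pi) auto
  finally show ?thesis by simp
qed

lemma b_seq_odd: "b_seq h u (2 * k + 1) = expi (of_int (u * tri k) / of_int h)"
  by (simp add: b_seq_def)

lemma b_seq_even: "b_seq h u (2 * k) = 0"
  by (simp add: b_seq_def)

lemma b_seq_cong:
  assumes "h > 0" and "[u = v] (mod h)"
  shows "b_seq h u = b_seq h v"
proof
  fix n
  obtain c where c: "u = v + h * c"
    using assms(2) by (metis cong_iff_lin cong_sym)
  have "of_int (u * t) / of_int h = of_int (v * t) / of_int h + (of_int (c * t) :: real)" for t
    using assms(1) by (simp add: c field_simps)
  then show "b_seq h u n = b_seq h v n"
    by (simp only: b_seq_def expi_add_int)
qed

lemma tri_shift: "even h \<Longrightarrow> tri (k + 2 * h) = tri k + h * (2 * k + 1 + 2 * h)"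
proof -
  have "(k + 2 * h) * (k + 2 * h + 1) = k * (k + 1) + 2 * (h * (2 * k + 1 + 2 * h))"
    by (simp add: algebra_simps)
  then show ?thesis
    unfolding tri_def by simp
qed

lemma b_seq_periodic:
  assumes "h > 0" and "even h"
  shows "b_seq h u (n + 4 * h) = b_seq h u n"
proof (cases "odd n")
  case True
  then obtain k where n: "n = 2 * k + 1" by (elim oddE)
  have n': "n + 4 * h = 2 * (k + 2 * h) + 1" by (simp add: n)
  have "of_int (u * tri (k + 2 * h)) / of_int h =
      of_int (u * tri k) / of_int h + (of_int (u * (2 * k + 1 + 2 * h)) :: real)"
    using assms(1) by (simp add: tri_shift[OF assms(2)] distrib_left add_divide_distrib)
  then show ?thesis
    unfolding n' b_seq_odd unfolding n b_seq_odd by (simp only: expi_add_int)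
qed (simp add: b_seq_def)

lemma mod_in_Units:
  assumes "n > 1" and "coprime x n"
  shows "x mod n \<in> Units (residue_ring n)"
proof -
  interpret R: residues n "residue_ring n"
    using assms(1) by unfold_locales auto
  have "coprime (x mod n) n"
    using assms by (subst coprime_mod_left_iff) auto
  moreover from this have "x mod n \<noteq> 0"
    using assms(1) by (auto simp: coprime_0_left_iff)
  moreover have "x mod n \<ge> 0" "x mod n < n"
    using assms(1) by auto
  ultimately show ?thesis
    by (simp add: R.res_units_eq)
qed

lemma neg_inv_Units:
  assumes "n > 1" and "a \<in> Units (residue_ring n)"
  shows "neg_inv n a \<in> Units (residue_ring n)"
proof -
  interpret R: residues n "residue_ring n"
    using assms(1) by unfold_locales auto
  have "inv\<^bsub>residue_ring n\<^esub> a \<in> Units (residue_ring n)"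
    using assms(2) by (rule R.Units_inv_Units)
  then have "coprime (- (inv\<^bsub>residue_ring n\<^esub> a)) n"
    by (simp add: R.res_units_eq)
  then show ?thesis
    unfolding neg_inv_def R.res_neg_eq using assms(1) by (intro mod_in_Units)
qed

lemma add_half_Units:
  assumes "h \<ge> 2" and "even h" and "\<alpha> \<in> Units (residue_ring (2 * h))"
  shows "\<alpha> \<oplus>\<^bsub>residue_ring (2 * h)\<^esub> h \<in> Units (residue_ring (2 * h))"
proof -
  interpret R: residues "2 * h" "residue_ring (2 * h)"
    using assms(1) by unfold_locales auto
  have "coprime \<alpha> (2 * h)"
    using assms(3) by (simp add: R.res_units_eq)
  then have "coprime \<alpha> h" and "odd \<alpha>"
    by simp_all
  then have "coprime (\<alpha> + h) h" and "odd (\<alpha> + h)"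
    using assms(2) by (simp_all add: coprime_iff_gcd_eq_1)
  then have "coprime (\<alpha> + h) (2 * h)"
    by simp
  then show ?thesis
    unfolding R.res_add_eq using assms(1) by (intro mod_in_Units) auto
qed

end

theory Submission
  imports Defs
begin

text \<open>
  On an odd residue \<open>2k + 1\<close> the summand of \<open>\<F> b\<^sub>\<alpha> (r)\<close> is \<open>e((2uk\<^sup>2 + 2k(u + r) + r) / 4h)\<close>,
  a quadratic phase in \<open>k\<close> modulo \<open>2h\<close>. If \<open>r\<close> is even, \<open>k \<mapsto> k + h\<close> changes its sign,
  so the sum vanishes (\<open>fourier_b_seq_even\<close>). If \<open>r = 2s + 1\<close>, then \<open>u + r\<close> is twice
  \<open>d + s\<close>, and completing the square gives a Gauss sum times a phase quadratic in \<open>s\<close>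
  (\<open>fourier_b_seq_odd\<close>). At \<open>s = 0\<close> this is \<open>C\<^sub>\<alpha>\<close>, so \<open>C\<^sub>\<alpha> = (\<F> b\<^sub>\<alpha>)(1)\<close> sees only \<open>b\<^sub>\<alpha>\<close> and
  not the representatives; and the ratio to the value at \<open>s = 0\<close> is \<open>e(-U T\<^sub>s / h)\<close>, which is
  the eigenvector relation (\<open>fourier_b_seq_eq\<close>).

  The constants need no evaluation of a Gauss sum. Since \<open>b\<^sub>\<alpha>\<close> is even and takes the value
  \<open>1\<close> at \<open>1\<close>, Fourier inversion applied to \<open>b\<^sub>\<alpha>\<close> gives \<open>C\<^sub>\<alpha> C\<^sub>\<beta> = M\<close> with \<open>\<beta> = \<alpha>\<^sup>\<or>\<close>
  (\<open>fourier_constant_mult\<close>). The kernel of \<open>\<F>\<close> is symmetric, so pairing \<open>b\<^sub>\<beta>\<close> with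
  \<open>b\<^bsub>-\<alpha>\<^esub>\<close> in both ways gives \<open>C\<^sub>\<beta> = C\<^bsub>-\<alpha>\<^esub>\<close>, which is the conjugate of \<open>C\<^sub>\<alpha>\<close>
  (\<open>cnj_fourier_constant\<close>); together these say \<open>|C\<^sub>\<alpha>|\<^sup>2 = M\<close>.

  All of this is carried out for integers \<open>u\<close>, \<open>v\<close> with \<open>uv \<equiv> -1\<close> modulo \<open>2h\<close>. The passage
  to residue rings rests on two facts: that \<open>neg_inv n a\<close> is the unique solution \<open>x\<close> of \<open>ax \<equiv> -1\<close> in
  the carrier (\<open>neg_inv_eqI\<close>), and that \<open>b\<^sub>\<alpha>\<close>, hence \<open>C\<^sub>\<alpha>\<close>, depends only on \<open>\<alpha>\<close> modulo \<open>h\<close>.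
\<close>

section \<open>Additive characters and sums over residues\<close>

text \<open>
  The phases below are quotients of integers by \<open>4h\<close> or \<open>2h\<close>. Keeping the integer numerator
  turns identities between exponentials into congruences.
\<close>

definition echar :: "int \<Rightarrow> int \<Rightarrow> complex" where
  "echar N a = expi (of_int a / of_int N)"

lemma expi_conv_cis: "expi x = cis (2 * pi * x)"
  by (simp add: expi_def cis_conv_exp mult_ac)

lemma expi_add: "expi (x + y) = expi x * expi y"
  by (simp add: expi_conv_cis cis_mult distrib_left)

lemma cnj_expi: "cnj (expi x) = expi (- x)"
  by (simp add: expi_conv_cis cis_cnj)

lemma echar_add: "echar N (a + b) = echar N a * echar N b"
  by (simp add: echar_def add_divide_distrib expi_add)

lemma echar_0 [simp]: "echar N 0 = 1"
  by (simp add: echar_def expi_def)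

lemma cnj_echar: "cnj (echar N a) = echar N (- a)"
  by (simp add: echar_def cnj_expi)

lemma echar_scale: "c \<noteq> 0 \<Longrightarrow> echar (c * N) (c * a) = echar N a"
  by (simp add: echar_def)

lemma echar_cong:
  assumes "N > 0" and "[a = b] (mod N)"
  shows "echar N a = echar N b"
proof -
  obtain c where "a = b + N * c"
    using assms(2) by (metis cong_iff_lin cong_sym)
  then have "of_int a / of_int N = of_int b / of_int N + (of_int c :: real)"
    using assms(1) by (simp add: field_simps)
  then show ?thesis
    by (simp only: echar_def expi_add_int)
qed

lemma echar_eq_1_iff:
  assumes "N > 0"
  shows "echar N a = 1 \<longleftrightarrow> N dvd a"
proof
  assume "echar N a = 1"
  then have "cos (2 * pi * (of_int a / of_int N)) = 1"
    by (simp add: echar_def expi_conv_cis complex_eq_iff)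
  then obtain n :: int where "2 * pi * (of_int a / of_int N) = of_int n * 2 * pi"
    by (auto simp: cos_one_2pi_int)
  then have "(of_int a :: real) = of_int (N * n)"
    using assms by (simp add: field_simps)
  then show "N dvd a"
    by (metis of_int_eq_iff dvd_triv_left)
next
  assume "N dvd a"
  then have "echar N a = echar N 0"
    using assms by (intro echar_cong) (simp_all add: cong_0_iff)
  then show "echar N a = 1"
    by simp
qed

text \<open>
  Adding \<open>c\<close> permutes the residues. Substitutions \<open>k \<mapsto> k + c\<close> in complete sums, including
  the completion of the square, go through this lemma.
\<close>

lemma sum_residues_shift:
  fixes f :: "int \<Rightarrow> 'a::comm_monoid_add"
  assumes "N > 0" and f: "\<And>j k. [j = k] (mod N) \<Longrightarrow> f j = f k"
  shows "(\<Sum>k\<in>{0..<N}. f (k + c)) = (\<Sum>k\<in>{0..<N}. f k)"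
proof (rule sum.reindex_bij_witness[where i = "\<lambda>k. (k - c) mod N" and j = "\<lambda>k. (k + c) mod N"])
  fix k assume "k \<in> {0..<N}"
  then show "((k + c) mod N - c) mod N = k" "((k - c) mod N + c) mod N = k"
    by (simp_all add: mod_simps)
  show "f ((k + c) mod N) = f (k + c)"
    by (rule f) simp
qed (use assms(1) in auto)

lemma sum_odd_supported:
  fixes f :: "int \<Rightarrow> 'a::comm_monoid_add"
  assumes "\<And>k. f (2 * k) = 0"
  shows "(\<Sum>m\<in>{0..<2 * N}. f m) = (\<Sum>k\<in>{0..<N}. f (2 * k + 1))"
proof -
  have "(\<Sum>m\<in>{0..<2 * N}. f m) = (\<Sum>m\<in>{m\<in>{0..<2 * N}. odd m}. f m)"
    using assms by (intro sum.mono_neutral_right) (auto elim: evenE)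
  also have "\<dots> = (\<Sum>k\<in>{0..<N}. f (2 * k + 1))"
    by (rule sum.reindex_bij_witness[where i = "\<lambda>k. 2 * k + 1" and j = "\<lambda>m. m div 2"]) auto
  finally show ?thesis .
qed

section \<open>The finite Fourier transform\<close>

lemma fourier_echar: "fourier M f r = (\<Sum>m\<in>{0..<M}. f m * echar M (m * r))"
  by (simp add: fourier_def echar_def)

lemma fourier_scale: "fourier M (\<lambda>m. c * f m) r = c * fourier M f r"
  by (simp add: fourier_def sum_distrib_left mult.assoc)

lemma cnj_fourier: "cnj (fourier M f r) = fourier M (\<lambda>m. cnj (f m)) (- r)"
  by (simp add: fourier_echar cnj_echar)

text \<open>
  The kernel \<open>e(mr / M)\<close> is symmetric in \<open>m\<close> and \<open>r\<close>, so \<open>\<F>\<close> is self-adjoint for the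
  bilinear (unconjugated) pairing.
\<close>

lemma sum_fourier_mult_commute:
  "(\<Sum>r\<in>{0..<M}. fourier M f r * g r) = (\<Sum>m\<in>{0..<M}. f m * fourier M g m)"
proof -
  have "(\<Sum>r\<in>{0..<M}. fourier M f r * g r)
      = (\<Sum>r\<in>{0..<M}. \<Sum>m\<in>{0..<M}. f m * echar M (m * r) * g r)"
    by (simp add: fourier_echar sum_distrib_right)
  also have "\<dots> = (\<Sum>m\<in>{0..<M}. \<Sum>r\<in>{0..<M}. f m * echar M (m * r) * g r)"
    by (rule sum.swap)
  also have "\<dots> = (\<Sum>m\<in>{0..<M}. f m * fourier M g m)"
    by (simp add: fourier_echar sum_distrib_left mult_ac)
  finally show ?thesis .
qed

text \<open>
  Orthogonality of characters: the shift \<open>n \<mapsto> n + 1\<close> multiplies the sum by \<open>e(x / M)\<close>, so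
  it vanishes unless this factor is \<open>1\<close>.
\<close>

lemma sum_echar:
  assumes "M > 0"
  shows "(\<Sum>n\<in>{0..<M}. echar M (n * x)) = (if M dvd x then of_int M else 0)"
proof (cases "M dvd x")
  case True
  then have "echar M (n * x) = 1" for n
    using assms by (simp add: echar_eq_1_iff)
  then show ?thesis
    using True assms by simp
next
  case False
  let ?S = "\<Sum>n\<in>{0..<M}. echar M (n * x)"
  have "?S = (\<Sum>n\<in>{0..<M}. echar M ((n + 1) * x))"
    using assms by (intro sum_residues_shift[symmetric] echar_cong cong_mult) auto
  also have "\<dots> = ?S * echar M x"
    by (simp add: distrib_right echar_add sum_distrib_right)
  finally have "?S = ?S * echar M x" .
  moreover have "echar M x \<noteq> 1"
    using False assms by (simp add: echar_eq_1_iff)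
  ultimately show ?thesis
    using False by simp
qed

text \<open>
  Fourier inversion in unnormalized form: orthogonality leaves only the term \<open>m \<equiv> -r\<close>. The
  argument is reduced because \<open>f\<close> is sampled on \<open>{0..<M}\<close> and may fail to be periodic.
\<close>

lemma fourier_fourier:
  assumes "M > 0"
  shows "fourier M (fourier M f) r = of_int M * f ((- r) mod M)"
proof -
  have dvd_iff: "M dvd m + r \<longleftrightarrow> m = (- r) mod M" if "m \<in> {0..<M}" for m
  proof -
    have "M dvd m + r \<longleftrightarrow> m mod M = (- r) mod M"
      by (simp add: mod_eq_dvd_iff)
    then show ?thesis
      using that by simp
  qed
  have "fourier M (fourier M f) r
      = (\<Sum>m\<in>{0..<M}. f m * fourier M (\<lambda>n. echar M (n * r)) m)"
    unfolding sum_fourier_mult_commute[symmetric] by (simp add: fourier_echar)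
  also have "\<dots> = (\<Sum>m\<in>{0..<M}. f m * (\<Sum>n\<in>{0..<M}. echar M (n * (m + r))))"
    by (simp add: fourier_echar echar_add[symmetric] algebra_simps)
  also have "\<dots> = (\<Sum>m\<in>{0..<M}. if m = (- r) mod M then f m * of_int M else 0)"
    using assms dvd_iff by (intro sum.cong) (auto simp: sum_echar)
  also have "\<dots> = of_int M * f ((- r) mod M)"
    using assms by simp
  finally show ?thesis .
qed

section \<open>Quadratic phases on the odd residues\<close>

lemma two_tri: "2 * tri k = k * (k + 1)"
  by (simp add: tri_def)

lemma tri_reflect: "tri (- k - 1) = tri k"
  by (simp add: tri_def algebra_simps)

text \<open>
  Denominator \<open>4h\<close> absorbs the \<open>1/2\<close> in \<open>T\<^sub>k\<close> and matches the Fourier kernel.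
\<close>

lemma b_seq_odd_echar: "h > 0 \<Longrightarrow> b_seq h u (2 * k + 1) = echar (4 * h) (2 * u * (k * (k + 1)))"
proof -
  have "2 * u * (k * (k + 1)) = 4 * (u * tri k)"
    by (simp flip: two_tri)
  then show ?thesis
    using echar_scale[of 4 h "u * tri k"] by (simp only: b_seq_odd echar_def[of h])
qed

lemma b_seq_at_1: "b_seq h u 1 = 1"
  using b_seq_odd[of h u 0] by (simp add: tri_def expi_def)

text \<open>
  The reflection \<open>n \<mapsto> -n\<close> sends \<open>2k + 1\<close> to \<open>2(-k - 1) + 1\<close>, and \<open>T\<^bsub>-k-1\<^esub> = T\<^sub>k\<close>.
\<close>

lemma b_seq_uminus: "b_seq h u (- n) = b_seq h u n"
proof (cases "odd n")
  case True
  then obtain k where n: "n = 2 * k + 1" by (elim oddE)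
  then have "- n = 2 * (- k - 1) + 1" by simp
  then show ?thesis
    unfolding n b_seq_odd by (simp only: b_seq_odd tri_reflect)
qed (simp add: b_seq_def)

lemma b_seq_mod:
  assumes h: "h > 0" "even h"
  shows "b_seq h u (n mod (4 * h)) = b_seq h u n"
proof -
  have step: "b_seq h u (m + 4 * h * int k) = b_seq h u m" for m k
  proof (induction k)
    case (Suc k)
    then show ?case
      using b_seq_periodic[OF h, of u "m + 4 * h * int k"] by (simp add: algebra_simps)
  qed simp
  show ?thesis
  proof (cases "n div (4 * h) \<ge> 0")
    case True
    then show ?thesis
      using step[of "n mod (4 * h)" "nat (n div (4 * h))"] by simp
  next
    case False
    then show ?thesis
      using step[of n "nat (- (n div (4 * h)))"] by (simp add: minus_mult_div_eq_mod[symmetric])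
  qed
qed

lemma cnj_b_seq: "cnj (b_seq h u n) = b_seq h (- u) n"
  by (simp add: b_seq_def cnj_expi)

text \<open>
  This is the squared norm of \<open>b\<^sub>u\<close>, since \<open>b\<^bsub>-u\<^esub>\<close> is its conjugate: there are \<open>2h\<close> odd
  residues modulo \<open>4h\<close>, each contributing \<open>1\<close>.
\<close>

lemma sum_b_seq_mult_uminus:
  assumes "h > 0"
  shows "(\<Sum>m\<in>{0..<4 * h}. b_seq h u m * b_seq h (- u) m) = of_int (2 * h)"
proof -
  have "(\<Sum>m\<in>{0..<2 * (2 * h)}. b_seq h u m * b_seq h (- u) m)
      = (\<Sum>k\<in>{0..<2 * h}. b_seq h u (2 * k + 1) * b_seq h (- u) (2 * k + 1))"
    by (rule sum_odd_supported) (simp add: b_seq_even)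
  also have "\<dots> = (\<Sum>k\<in>{0..<2 * h}. 1)"
    using assms by (simp only: b_seq_odd_echar echar_add[symmetric]) simp
  finally show ?thesis
    using assms by simp
qed

lemma fourier_b_seq:
  assumes "h > 0"
  shows "fourier (4 * h) (b_seq h u) r
    = (\<Sum>k\<in>{0..<2 * h}. echar (4 * h) (2 * u * k\<^sup>2 + 2 * k * (u + r) + r))"
proof -
  have "fourier (4 * h) (b_seq h u) r
      = (\<Sum>m\<in>{0..<2 * (2 * h)}. b_seq h u m * echar (4 * h) (m * r))"
    by (simp add: fourier_echar)
  also have "\<dots> = (\<Sum>k\<in>{0..<2 * h}. b_seq h u (2 * k + 1) * echar (4 * h) ((2 * k + 1) * r))"
    by (rule sum_odd_supported) (simp add: b_seq_even)
  also have "\<dots> = (\<Sum>k\<in>{0..<2 * h}. echar (4 * h) (2 * u * k\<^sup>2 + 2 * k * (u + r) + r))"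
  proof (intro sum.cong refl)
    fix k
    have "2 * u * (k * (k + 1)) + (2 * k + 1) * r = 2 * u * k\<^sup>2 + 2 * k * (u + r) + r"
      by (simp add: algebra_simps power2_eq_square)
    then show "b_seq h u (2 * k + 1) * echar (4 * h) ((2 * k + 1) * r)
        = echar (4 * h) (2 * u * k\<^sup>2 + 2 * k * (u + r) + r)"
      by (simp only: b_seq_odd_echar[OF assms] echar_add[symmetric])
  qed
  finally show ?thesis .
qed

lemma cong_if_eq_add_mult: "a = b + n * c \<Longrightarrow> [a = b] (mod (n::int))"
  by (simp add: cong_iff_dvd_diff)

lemma cong_double: "[a = b] (mod N) \<Longrightarrow> [2 * a = 2 * b] (mod 2 * (N::int))"
  by (auto simp: cong_iff_dvd_diff algebra_simps simp flip: right_diff_distrib)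

text \<open>
  The shift \<open>k \<mapsto> k + h\<close> adds \<open>4ukh + 2uh\<^sup>2 + 2h(u + r)\<close> to the exponent. Modulo \<open>4h\<close> the
  first two terms vanish because \<open>h\<close> is even, and the last is \<open>2h\<close> because \<open>u + r\<close> is odd;
  so every summand changes sign.
\<close>

lemma fourier_b_seq_even:
  assumes "h > 0" and "even h" and "odd u" and "even r"
  shows "fourier (4 * h) (b_seq h u) r = 0"
proof -
  let ?q = "\<lambda>k. u * k\<^sup>2 + k * (u + r)"
  let ?f = "\<lambda>k. echar (4 * h) (2 * ?q k + r)"
  let ?S = "\<Sum>k\<in>{0..<2 * h}. ?f k"
  have per: "?f j = ?f k" if "[j = k] (mod 2 * h)" for j k
  proof -
    have "[?q j = ?q k] (mod 2 * h)"
      using that by (intro cong_add cong_mult cong_pow) auto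
    then have "[2 * ?q j + r = 2 * ?q k + r] (mod 4 * h)"
      using cong_double[of "?q j" "?q k" "2 * h"] by (intro cong_add) auto
    then show ?thesis
      using assms(1) by (intro echar_cong) auto
  qed
  have half: "echar (4 * h) (2 * h) = - 1"
    using assms(1) by (simp add: echar_def expi_conv_cis)
  have neg: "?f (k + h) = - ?f k" for k
  proof -
    obtain h' where h': "h = 2 * h'" using assms(2) by (elim evenE)
    obtain w where w: "u + r = 2 * w + 1" using assms(3,4) by (metis odd_add oddE)
    have "2 * ?q (k + h) + r = (2 * ?q k + r + 2 * h) + 4 * h * (u * k + u * h' + w)"
      by (simp add: w) (simp add: h' power2_eq_square algebra_simps)
    then have "[2 * ?q (k + h) + r = 2 * ?q k + r + 2 * h] (mod 4 * h)"
      by (simp add: cong_iff_dvd_diff)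
    then have "?f (k + h) = echar (4 * h) (2 * ?q k + r + 2 * h)"
      using assms(1) by (intro echar_cong) auto
    then show ?thesis
      by (simp add: echar_add half)
  qed
  have "?S = (\<Sum>k\<in>{0..<2 * h}. ?f (k + h))"
    using assms(1) by (intro sum_residues_shift[symmetric] per) auto
  also have "\<dots> = - ?S"
    by (simp only: neg sum_negf)
  finally have "?S = 0"
    by simp
  moreover have "2 * u * k\<^sup>2 + 2 * k * (u + r) + r = 2 * ?q k + r" for k
    by simp
  ultimately show ?thesis
    by (simp only: fourier_b_seq[OF assms(1)])
qed

text \<open>
  With \<open>u + r = 2(d + s)\<close> the exponent is \<open>2uk\<^sup>2 + 4k(d + s) + r\<close>, which modulo \<open>4h\<close> is
  \<open>2u(k + U(d + s))\<^sup>2 - 2U(d + s)\<^sup>2 + r\<close>: the leading factor \<open>2\<close> makes \<open>Uu \<equiv> 1\<close> modulo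
  \<open>2h\<close> sufficient. The shift by \<open>U(d + s)\<close> is then removed from the Gauss sum.
\<close>

lemma fourier_b_seq_odd:
  assumes "h > 0" and "odd u" and inv: "[U * u = 1] (mod 2 * h)"
  shows "fourier (4 * h) (b_seq h u) (2 * s + 1)
    = echar (4 * h) (2 * s + 1 - 2 * U * ((u + 1) div 2 + s)\<^sup>2) * gauss_sum u (2 * h)"
proof -
  define d where "d = (u + 1) div 2"
  have d: "u + 1 = 2 * d"
    using assms(2) by (auto simp: d_def elim: oddE)
  define c where "c = U * (d + s)"
  define t where "t = 2 * s + 1 - 2 * U * (d + s)\<^sup>2"
  have square: "echar (4 * h) (2 * u * k\<^sup>2 + 2 * k * (u + (2 * s + 1)) + (2 * s + 1))
      = echar (4 * h) t * echar (2 * h) (u * (k + c)\<^sup>2)" for k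
  proof -
    obtain j where j: "U * u = 1 + 2 * h * j"
      using inv by (metis cong_iff_lin cong_sym)
    have "u * (k + c)\<^sup>2 = u * k\<^sup>2 + 2 * (U * u) * k * (d + s) + (U * u) * U * (d + s)\<^sup>2"
      by (simp add: c_def power2_eq_square algebra_simps)
    also have "\<dots> = u * k\<^sup>2 + 2 * k * (d + s) + U * (d + s)\<^sup>2
        + 2 * h * (j * (2 * k * (d + s) + U * (d + s)\<^sup>2))"
      unfolding j by (simp add: algebra_simps)
    finally have *: "2 * (u * (k + c)\<^sup>2) + t
        = 2 * u * k\<^sup>2 + 4 * k * (d + s) + (2 * s + 1)
          + 4 * h * (j * (2 * k * (d + s) + U * (d + s)\<^sup>2))"
      unfolding t_def by (simp add: algebra_simps)
    have w: "u + (2 * s + 1) = 2 * (d + s)"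
      using d by simp
    have "2 * u * k\<^sup>2 + 2 * k * (u + (2 * s + 1)) + (2 * s + 1)
        = 2 * u * k\<^sup>2 + 4 * k * (d + s) + (2 * s + 1)"
      unfolding w by (simp add: algebra_simps)
    then have "t + 2 * (u * (k + c)\<^sup>2) = 2 * u * k\<^sup>2 + 2 * k * (u + (2 * s + 1)) + (2 * s + 1)
        + 4 * h * (j * (2 * k * (d + s) + U * (d + s)\<^sup>2))"
      using * by linarith
    then have "[2 * u * k\<^sup>2 + 2 * k * (u + (2 * s + 1)) + (2 * s + 1)
        = t + 2 * (u * (k + c)\<^sup>2)] (mod 4 * h)"
      by (rule cong_if_eq_add_mult[THEN cong_sym])
    then have "echar (4 * h) (2 * u * k\<^sup>2 + 2 * k * (u + (2 * s + 1)) + (2 * s + 1))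
        = echar (4 * h) (t + 2 * (u * (k + c)\<^sup>2))"
      using assms(1) by (intro echar_cong) auto
    then show ?thesis
      using echar_scale[of 2 "2 * h" "u * (k + c)\<^sup>2"] by (simp add: echar_add)
  qed
  have "fourier (4 * h) (b_seq h u) (2 * s + 1)
      = echar (4 * h) t * (\<Sum>k\<in>{0..<2 * h}. echar (2 * h) (u * (k + c)\<^sup>2))"
    using assms(1) by (simp only: fourier_b_seq square sum_distrib_left)
  also have "(\<Sum>k\<in>{0..<2 * h}. echar (2 * h) (u * (k + c)\<^sup>2))
      = (\<Sum>k\<in>{0..<2 * h}. echar (2 * h) (u * k\<^sup>2))"
    using assms(1) by (intro sum_residues_shift echar_cong cong_mult cong_pow) auto
  also have "\<dots> = gauss_sum u (2 * h)"
    by (simp add: gauss_sum_def echar_def)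
  finally show ?thesis
    by (simp add: t_def d_def)
qed

text \<open>
  The right-hand side mentions neither \<open>U\<close> nor more of \<open>u\<close> than the sequence itself: this is
  what makes \<open>C\<^sub>\<alpha>\<close> independent of representatives.
\<close>

lemma C_rep_eq_fourier:
  assumes "h > 0" and "odd u" and "[U * u = 1] (mod 2 * h)"
  shows "C_rep h u U = fourier (4 * h) (b_seq h u) 1"
proof -
  define d where "d = (u + 1) div 2"
  have "expi (1 / (4 * of_int h) - of_int (U * d\<^sup>2) / (2 * of_int h)) = echar (4 * h) (1 - 2 * U * d\<^sup>2)"
    using assms(1) by (simp add: echar_def diff_divide_distrib)
  then show ?thesis
    using fourier_b_seq_odd[OF assms, of 0] by (simp add: C_rep_def Let_def d_def)
qed

text \<open>
  The inverse of \<open>u\<close> modulo \<open>2h\<close> is \<open>U = -v\<close>. Subtracting the exponent at \<open>s = 0\<close> from that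
  at \<open>s\<close> leaves \<open>2s + 2v(2ds + s\<^sup>2)\<close>; as \<open>2d = u + 1\<close> and \<open>vu \<equiv> -1\<close>, the linear term
  becomes \<open>2vs\<close>, and the total \<open>2vs(s + 1)\<close> is the phase of \<open>b\<^sub>v(2s + 1)\<close>.
\<close>

theorem fourier_b_seq_eq:
  assumes "h > 0" and "even h" and "[u * v = - 1] (mod 2 * h)"
  shows "fourier (4 * h) (b_seq h u) = (\<lambda>r. fourier (4 * h) (b_seq h u) 1 * b_seq h v r)"
proof
  fix r
  have "even (u * v + 1)"
    using assms(3) by (auto simp: cong_iff_dvd_diff dest: dvd_mult_left)
  then have u: "odd u"
    by auto
  have inv: "[(- v) * u = 1] (mod 2 * h)"
    using assms(3) cong_minus_minus_iff[of "u * v" "- 1" "2 * h"] by (simp add: mult.commute)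
  show "fourier (4 * h) (b_seq h u) r = fourier (4 * h) (b_seq h u) 1 * b_seq h v r"
  proof (cases "odd r")
    case False
    then show ?thesis
      using assms u by (simp add: fourier_b_seq_even b_seq_def)
  next
    case True
    then obtain s where s: "r = 2 * s + 1" by (elim oddE)
    obtain j where j: "u * v = - 1 + 2 * h * j"
      using assms(3) by (metis cong_iff_lin cong_sym)
    define d where "d = (u + 1) div 2"
    have d: "2 * d = u + 1"
      using u by (auto simp: d_def elim: oddE)
    have "2 * s + 1 - 2 * (- v) * (d + s)\<^sup>2
        = 1 + 2 * v * d\<^sup>2 + 2 * s + 2 * v * s * (2 * d) + 2 * v * s\<^sup>2"
      by (simp add: power2_eq_square algebra_simps)
    also have "\<dots> = 1 + 2 * v * d\<^sup>2 + 2 * s + 2 * s * (u * v) + 2 * v * s + 2 * v * s\<^sup>2"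
      unfolding d by (simp add: algebra_simps)
    also have "\<dots> = (1 - 2 * (- v) * d\<^sup>2) + 2 * v * (s * (s + 1)) + 4 * h * (s * j)"
      unfolding j by (simp add: power2_eq_square algebra_simps)
    finally have "[2 * s + 1 - 2 * (- v) * (d + s)\<^sup>2
        = (1 - 2 * (- v) * d\<^sup>2) + 2 * v * (s * (s + 1))] (mod 4 * h)"
      by (rule cong_if_eq_add_mult)
    then have "echar (4 * h) (2 * s + 1 - 2 * (- v) * (d + s)\<^sup>2)
        = echar (4 * h) (1 - 2 * (- v) * d\<^sup>2) * b_seq h v r"
      using assms(1) unfolding s
      by (simp only: b_seq_odd_echar echar_add[symmetric]) (intro echar_cong, auto)
    then show ?thesis
      using fourier_b_seq_odd[OF assms(1) u inv, of s] fourier_b_seq_odd[OF assms(1) u inv, of 0]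
      by (simp add: s d_def)
  qed
qed

section \<open>The eigenvalue constants\<close>

text \<open>
  Applying \<open>\<F>\<close> twice to \<open>b\<^sub>u\<close> and evaluating at \<open>1\<close>: the eigenvector relation gives
  \<open>C\<^sub>u C\<^sub>v\<close>, inversion gives \<open>M b\<^sub>u(-1) = M\<close>.
\<close>

lemma fourier_constant_mult:
  assumes "h > 0" and "even h" and "[u * v = - 1] (mod 2 * h)"
  shows "fourier (4 * h) (b_seq h u) 1 * fourier (4 * h) (b_seq h v) 1 = of_int (4 * h)"
proof -
  let ?C = "\<lambda>u. fourier (4 * h) (b_seq h u) 1"
  have "fourier (4 * h) (fourier (4 * h) (b_seq h u)) 1 = ?C u * ?C v"
    by (subst fourier_b_seq_eq[OF assms]) (rule fourier_scale)
  moreover have "fourier (4 * h) (fourier (4 * h) (b_seq h u)) 1 = of_int (4 * h)"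
    using fourier_fourier[of "4 * h" "b_seq h u" 1] assms(1)
    by (simp add: b_seq_mod[OF assms(1,2)] b_seq_uminus b_seq_at_1 del: zmod_minus1)
  ultimately show ?thesis
    by simp
qed

text \<open>
  Conjugation turns \<open>\<F> b\<^sub>u\<close> into \<open>\<F> b\<^bsub>-u\<^esub>\<close> up to reflection, so the conjugate of \<open>C\<^sub>u\<close> is
  \<open>C\<^bsub>-u\<^esub>\<close>. The dual of \<open>-u\<close> is \<open>-v\<close>, so moving \<open>\<F>\<close> across the pairing of \<open>b\<^sub>v\<close> with
  \<open>b\<^bsub>-u\<^esub>\<close> compares \<open>C\<^bsub>-u\<^esub> \<parallel>b\<^sub>v\<parallel>\<^sup>2\<close> with \<open>C\<^sub>v \<parallel>b\<^sub>u\<parallel>\<^sup>2\<close>, and both norms are \<open>2h\<close>.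
\<close>

lemma cnj_fourier_constant:
  assumes "h > 0" and "even h" and "[u * v = - 1] (mod 2 * h)"
  shows "cnj (fourier (4 * h) (b_seq h u) 1) = fourier (4 * h) (b_seq h v) 1"
proof -
  let ?C = "\<lambda>u. fourier (4 * h) (b_seq h u) 1"
  have uv: "[(- u) * (- v) = - 1] (mod 2 * h)" and vu: "[v * u = - 1] (mod 2 * h)"
    using assms(3) by (simp_all add: mult.commute)
  have "cnj (?C u) = fourier (4 * h) (b_seq h (- u)) (- 1)"
    by (simp add: cnj_fourier cnj_b_seq)
  also have "\<dots> = ?C (- u)"
    using fun_cong[OF fourier_b_seq_eq[OF assms(1,2) uv], of "- 1"]
    by (simp add: b_seq_uminus b_seq_at_1)
  also have "?C (- u) = ?C v"
  proof -
    have "?C (- u) * of_int (2 * h) = (\<Sum>r\<in>{0..<4 * h}. b_seq h v r * (?C (- u) * b_seq h (- v) r))"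
      by (simp only: sum_b_seq_mult_uminus[OF assms(1), of v, symmetric] sum_distrib_left
        mult.assoc mult.left_commute)
    also have "\<dots> = (\<Sum>r\<in>{0..<4 * h}. b_seq h v r * fourier (4 * h) (b_seq h (- u)) r)"
      by (subst (2) fourier_b_seq_eq[OF assms(1,2) uv]) (rule refl)
    also have "\<dots> = (\<Sum>r\<in>{0..<4 * h}. fourier (4 * h) (b_seq h v) r * b_seq h (- u) r)"
      by (rule sum_fourier_mult_commute[symmetric])
    also have "\<dots> = (\<Sum>r\<in>{0..<4 * h}. ?C v * b_seq h u r * b_seq h (- u) r)"
      by (subst fourier_b_seq_eq[OF assms(1,2) vu]) (rule refl)
    also have "\<dots> = ?C v * of_int (2 * h)"
      by (simp only: sum_b_seq_mult_uminus[OF assms(1), of u, symmetric] sum_distrib_left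
        mult.assoc mult.left_commute)
    finally show ?thesis
      using assms(1) by simp
  qed
  finally show ?thesis .
qed

lemma cmod_fourier_constant:
  assumes "h > 0" and "even h" and "[u * v = - 1] (mod 2 * h)"
  shows "cmod (fourier (4 * h) (b_seq h u) 1) = sqrt (of_int (4 * h))"
proof -
  let ?C = "fourier (4 * h) (b_seq h u) 1"
  have "complex_of_real ((cmod ?C)\<^sup>2) = of_int (4 * h)"
    using cnj_fourier_constant[OF assms] fourier_constant_mult[OF assms]
    by (simp only: complex_norm_square)
  then have "(cmod ?C)\<^sup>2 = of_int (4 * h)"
    by (metis of_real_eq_iff of_real_of_int_eq)
  then show ?thesis
    by (metis norm_ge_zero real_sqrt_unique)
qed

section \<open>The dual parameter in the residue rings\<close>

lemma Units_residue_ring: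
  "n > 1 \<Longrightarrow> Units (residue_ring n) = {x. 0 < x \<and> x < n \<and> coprime x n}"
  by (rule residues.res_units_eq[OF residues.intro]) auto

lemma cong_inv_residue_ring:
  assumes "n > 1" and "a \<in> Units (residue_ring n)"
  shows "[(inv\<^bsub>residue_ring n\<^esub> a) * a = 1] (mod n)"
proof -
  interpret R: residues n "residue_ring n"
    using assms(1) by unfold_locales auto
  have "(inv\<^bsub>residue_ring n\<^esub> a) \<otimes>\<^bsub>residue_ring n\<^esub> a = \<one>\<^bsub>residue_ring n\<^esub>"
    using assms(2) by (rule R.Units_l_inv)
  then show ?thesis
    using assms(1) by (simp add: R.res_mult_eq R.res_one_eq cong_def)
qed

lemma cong_mult_neg_inv:
  assumes "n > 1" and "a \<in> Units (residue_ring n)"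
  shows "[a * neg_inv n a = - 1] (mod n)"
proof -
  interpret R: residues n "residue_ring n"
    using assms(1) by unfold_locales auto
  let ?i = "inv\<^bsub>residue_ring n\<^esub> a"
  have "[neg_inv n a = - ?i] (mod n)"
    by (simp add: neg_inv_def R.res_neg_eq)
  then have "[a * neg_inv n a = a * - ?i] (mod n)"
    by (rule cong_scalar_left)
  also have "a * - ?i = - (?i * a)"
    by simp
  also have "[- (?i * a) = - 1] (mod n)"
    using cong_inv_residue_ring[OF assms] by (simp only: cong_minus_minus_iff)
  finally show ?thesis .
qed

text \<open>
  Units can be cancelled from a congruence, so the congruence determines the residue. The
  identities for the dual parameter reduce to congruences between integers this way.
\<close>

lemma neg_inv_eqI:
  assumes "n > 1" and "a \<in> Units (residue_ring n)"
    and "0 \<le> x" "x < n" and "[a * x = - 1] (mod n)"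
  shows "neg_inv n a = x"
proof -
  have "coprime a n"
    using assms(1,2) by (simp add: Units_residue_ring)
  moreover have "[a * neg_inv n a = a * x] (mod n)"
    using cong_mult_neg_inv[OF assms(1,2)] assms(5) by (metis cong_sym cong_trans)
  ultimately have "[neg_inv n a = x] (mod n)"
    by (simp add: cong_mult_lcancel)
  moreover have "0 \<le> neg_inv n a" "neg_inv n a < n"
    using neg_inv_Units[OF assms(1,2)] assms(1) by (simp_all add: Units_residue_ring)
  ultimately show ?thesis
    using assms(3,4) by (simp add: cong_def)
qed

lemma neg_inv_neg_inv:
  assumes "n > 1" and "a \<in> Units (residue_ring n)"
  shows "neg_inv n (neg_inv n a) = a"
  using assms cong_mult_neg_inv[OF assms]
  by (intro neg_inv_eqI neg_inv_Units) (auto simp: Units_residue_ring mult.commute)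

text \<open>
  A unit modulo the even number \<open>h\<close> is odd, and so is its translate by \<open>h\<close>; hence both
  residues modulo \<open>2h\<close> above it are units.
\<close>

lemma lifts_eq:
  assumes "h \<ge> 2" and "even h" and "u \<in> Units (residue_ring h)"
  shows "lifts h u = {u, u + h}"
proof -
  have u: "0 < u" "u < h" "coprime u h"
    using assms(1,3) by (simp_all add: Units_residue_ring)
  then have odd: "odd u"
    using assms(2) by (meson coprime_common_divisor odd_one)
  have "coprime (u + h) h"
    using u(3) by (simp add: coprime_iff_gcd_eq_1)
  then have "u \<in> lifts h u" "u + h \<in> lifts h u"
    using assms(1,2) u odd by (simp_all add: lifts_def Units_residue_ring)
  moreover have "\<alpha> = u \<or> \<alpha> = u + h" if "\<alpha> \<in> lifts h u" for \<alpha>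
  proof -
    have \<alpha>: "0 < \<alpha>" "\<alpha> < 2 * h" "\<alpha> mod h = u"
      using that assms(1) by (simp_all add: lifts_def Units_residue_ring)
    show ?thesis
    proof (cases "\<alpha> < h")
      case True
      then show ?thesis using \<alpha> by simp
    next
      case False
      then have "(\<alpha> - h) mod h = \<alpha> - h"
        using \<alpha> by (intro mod_pos_pos_trivial) auto
      then show ?thesis using \<alpha> by simp
    qed
  qed
  ultimately show ?thesis
    by blast
qed

lemma C_const_eq_fourier:
  assumes "h \<ge> 2" and "\<alpha> \<in> Units (residue_ring (2 * h))"
  shows "C_const h \<alpha> = fourier (4 * h) (b_seq h \<alpha>) 1"
  unfolding C_const_def using assms
  by (intro C_rep_eq_fourier cong_inv_residue_ring) (auto simp: Units_residue_ring)

lemma C_const_cong: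
  assumes "h \<ge> 2" and "\<alpha> \<in> Units (residue_ring (2 * h))" and "\<beta> \<in> Units (residue_ring (2 * h))"
    and "[\<alpha> = \<beta>] (mod h)"
  shows "C_const h \<alpha> = C_const h \<beta>"
  using assms b_seq_cong[of h \<alpha> \<beta>] by (simp add: C_const_eq_fourier)

lemma neg_inv_mod:
  assumes "h \<ge> 2" and "\<alpha> \<in> Units (residue_ring (2 * h))"
  shows "\<alpha> mod h \<in> Units (residue_ring h)" and "neg_inv (2 * h) \<alpha> mod h = neg_inv h (\<alpha> mod h)"
proof -
  show unit: "\<alpha> mod h \<in> Units (residue_ring h)"
    using assms by (intro mod_in_Units) (auto simp: Units_residue_ring)
  have "[\<alpha> * neg_inv (2 * h) \<alpha> = - 1] (mod h)"
    using cong_mult_neg_inv[OF _ assms(2)] assms(1) by (auto intro: cong_dvd_modulus)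
  then have "[\<alpha> mod h * (neg_inv (2 * h) \<alpha> mod h) = - 1] (mod h)"
    by (simp add: cong_def mod_simps)
  then show "neg_inv (2 * h) \<alpha> mod h = neg_inv h (\<alpha> mod h)"
    using assms(1) unit by (intro neg_inv_eqI[symmetric]) auto
qed

text \<open>
  With \<open>\<beta> = \<alpha>\<^sup>\<or>\<close>, the product \<open>(\<alpha> + h)(\<beta> + h)\<close> exceeds \<open>\<alpha>\<beta>\<close> by \<open>h(\<alpha> + \<beta> + h)\<close>, a multiple
  of \<open>2h\<close> since \<open>\<alpha>\<close> and \<open>\<beta>\<close> are odd and \<open>h\<close> is even.
\<close>

lemma neg_inv_add_half:
  assumes "h \<ge> 2" and "even h" and "\<alpha> \<in> Units (residue_ring (2 * h))"
  shows "neg_inv (2 * h) (\<alpha> \<oplus>\<^bsub>residue_ring (2 * h)\<^esub> h)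
    = neg_inv (2 * h) \<alpha> \<oplus>\<^bsub>residue_ring (2 * h)\<^esub> h"
proof (rule neg_inv_eqI)
  interpret R: residues "2 * h" "residue_ring (2 * h)"
    using assms(1) by unfold_locales auto
  let ?\<beta> = "neg_inv (2 * h) \<alpha>"
  show "2 * h > 1" using assms(1) by simp
  show "\<alpha> \<oplus>\<^bsub>residue_ring (2 * h)\<^esub> h \<in> Units (residue_ring (2 * h))"
    using assms by (rule add_half_Units)
  show "0 \<le> ?\<beta> \<oplus>\<^bsub>residue_ring (2 * h)\<^esub> h" "?\<beta> \<oplus>\<^bsub>residue_ring (2 * h)\<^esub> h < 2 * h"
    using assms(1) by (simp_all add: R.res_add_eq)
  have "?\<beta> \<in> Units (residue_ring (2 * h))"
    using assms by (intro neg_inv_Units) auto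
  then have "even (\<alpha> + ?\<beta> + h)"
    using assms by (simp add: Units_residue_ring)
  then obtain c where c: "\<alpha> + ?\<beta> + h = 2 * c" by (elim evenE)
  have "(\<alpha> + h) * (?\<beta> + h) = \<alpha> * ?\<beta> + h * (\<alpha> + ?\<beta> + h)"
    by (simp add: algebra_simps)
  also have "[\<dots> = \<alpha> * ?\<beta>] (mod 2 * h)"
    unfolding c by (simp add: cong_iff_dvd_diff)
  also have "[\<alpha> * ?\<beta> = - 1] (mod 2 * h)"
    using assms by (intro cong_mult_neg_inv) auto
  finally show "[(\<alpha> \<oplus>\<^bsub>residue_ring (2 * h)\<^esub> h) * (?\<beta> \<oplus>\<^bsub>residue_ring (2 * h)\<^esub> h) = - 1] (mod 2 * h)"
    by (simp add: R.res_add_eq cong_def mod_simps)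
qed

lemma desc_eq:
  assumes "h \<ge> 2" and "even h" and "u \<in> Units (residue_ring h)" and "\<alpha> \<in> lifts h u"
  shows "b_desc h u = b_seq h \<alpha>" and "gamma_desc h u = C_const h \<alpha>"
proof -
  define \<beta> where "\<beta> = (SOME \<alpha>. \<alpha> \<in> lifts h u)"
  have "\<beta> \<in> lifts h u"
    unfolding \<beta>_def using assms(4) by (rule someI)
  then have "[\<beta> = \<alpha>] (mod h)" "\<beta> \<in> Units (residue_ring (2 * h))" "\<alpha> \<in> Units (residue_ring (2 * h))"
    using assms(4) by (simp_all add: lifts_def cong_def)
  then show "b_desc h u = b_seq h \<alpha>" "gamma_desc h u = C_const h \<alpha>"
    unfolding b_desc_def gamma_desc_def \<beta>_def[symmetric]
    using assms(1) by (auto intro!: b_seq_cong C_const_cong)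
qed

theorem theorem3p2:
  fixes h M :: int
  defines "R \<equiv> residue_ring (2 * h)"
  assumes "h \<ge> 2" and "even h" and "M = 4 * h"
  shows
    \<comment> \<open>(i)\<close>
    "(\<forall>\<alpha>\<in>Units R.
        (\<forall>u U. odd u \<and> [u = \<alpha>] (mod 2 * h) \<and> [U * u = 1] (mod 2 * h)
           \<longrightarrow> C_rep h u U = C_const h \<alpha>) \<and>
        C_const h \<alpha> = fourier M (b_seq h \<alpha>) 1)
     \<and>
     \<comment> \<open>(ii)\<close>
     (\<forall>\<alpha>\<in>Units R.
        fourier M (b_seq h \<alpha>) = (\<lambda>r. C_const h \<alpha> * b_seq h (neg_inv (2 * h) \<alpha>) r))
     \<and>
     \<comment> \<open>(iii)\<close>
     (\<forall>\<alpha>\<in>Units R.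
        neg_inv (2 * h) (neg_inv (2 * h) \<alpha>) = \<alpha> \<and>
        neg_inv (2 * h) (\<alpha> \<oplus>\<^bsub>R\<^esub> h) = neg_inv (2 * h) \<alpha> \<oplus>\<^bsub>R\<^esub> h \<and>
        C_const h (\<alpha> \<oplus>\<^bsub>R\<^esub> h) = C_const h \<alpha>)
     \<and>
     \<comment> \<open>(iv)\<close>
     (\<forall>\<alpha>\<in>Units R.
        cmod (C_const h \<alpha>) = sqrt (of_int M) \<and>
        sqrt (of_int M) = 2 * sqrt (of_int h) \<and>
        C_const h \<alpha> * C_const h (neg_inv (2 * h) \<alpha>) = of_int M)
     \<and>
     \<comment> \<open>(v)\<close>
     (\<forall>u\<in>Units (residue_ring h).
        neg_inv h u \<in> Units (residue_ring h) \<and> neg_inv h (neg_inv h u) = u) \<and>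
     (\<forall>\<alpha>\<in>Units R. \<forall>\<beta>\<in>Units R. \<alpha> mod h = \<beta> mod h
        \<longrightarrow> b_seq h \<alpha> = b_seq h \<beta> \<and> C_const h \<alpha> = C_const h \<beta>) \<and>
     (\<forall>\<alpha>\<in>Units R.
        \<alpha> mod h \<in> Units (residue_ring h) \<and>
        neg_inv (2 * h) \<alpha> mod h = neg_inv h (\<alpha> mod h)) \<and>
     (\<forall>u\<in>Units (residue_ring h).
        card (lifts h u) = 2 \<and>
        (\<forall>\<alpha>\<in>lifts h u. b_desc h u = b_seq h \<alpha> \<and> gamma_desc h u = C_const h \<alpha>) \<and>
        fourier M (b_desc h u) = (\<lambda>r. gamma_desc h u * b_desc h (neg_inv h u) r))"
proof -
  have h: "h > 0" "h > 1" "2 * h > 1" and M: "M = 4 * h"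
    using assms by simp_all
  note half = add_half_Units[OF \<open>h \<ge> 2\<close> \<open>even h\<close>, folded R_def]
  note C = C_const_eq_fourier[OF \<open>h \<ge> 2\<close>, folded R_def]
  note dual = cong_mult_neg_inv[OF h(3), folded R_def]
  note dual_unit = neg_inv_Units[OF h(3), folded R_def]
  have rep: "C_rep h u U = C_const h \<alpha>"
    if "\<alpha> \<in> Units R" "odd u" "[u = \<alpha>] (mod 2 * h)" "[U * u = 1] (mod 2 * h)" for \<alpha> u U
  proof -
    have "[u = \<alpha>] (mod h)"
      using that(3) by (rule cong_dvd_modulus) simp
    then show ?thesis
      using that h b_seq_cong[of h u \<alpha>] by (simp add: C C_rep_eq_fourier)
  qed
  have transform: "fourier M (b_seq h \<alpha>) = (\<lambda>r. C_const h \<alpha> * b_seq h (neg_inv (2 * h) \<alpha>) r)"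
    if "\<alpha> \<in> Units R" for \<alpha>
    using fourier_b_seq_eq[OF h(1) \<open>even h\<close> dual[OF that]] by (simp add: M C[OF that])
  have C_half: "C_const h (\<alpha> \<oplus>\<^bsub>R\<^esub> h) = C_const h \<alpha>" if "\<alpha> \<in> Units R" for \<alpha>
  proof -
    interpret R: residues "2 * h" R
      using h by unfold_locales (auto simp: R_def)
    have "[(\<alpha> + h) mod (2 * h) = \<alpha>] (mod h)"
      by (simp add: cong_def mod_mod_cancel)
    then have "[\<alpha> \<oplus>\<^bsub>R\<^esub> h = \<alpha>] (mod h)"
      by (simp add: R.res_add_eq)
    then show ?thesis
      using that half[OF that] assms(2) unfolding R_def by (intro C_const_cong)
  qed
  have sqrt_M: "sqrt (of_int M) = 2 * sqrt (of_int h)"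
    by (simp add: M real_sqrt_mult)
  have norm_C: "cmod (C_const h \<alpha>) = sqrt (of_int M)" if "\<alpha> \<in> Units R" for \<alpha>
    using cmod_fourier_constant[OF h(1) \<open>even h\<close> dual[OF that]] by (simp add: M C[OF that])
  have mult_C: "C_const h \<alpha> * C_const h (neg_inv (2 * h) \<alpha>) = of_int M" if "\<alpha> \<in> Units R" for \<alpha>
    using fourier_constant_mult[OF h(1) \<open>even h\<close> dual[OF that]]
    by (simp add: M C[OF that] C[OF dual_unit[OF that]])
  have descends: "b_seq h \<alpha> = b_seq h \<beta> \<and> C_const h \<alpha> = C_const h \<beta>"
    if "\<alpha> \<in> Units R" "\<beta> \<in> Units R" "\<alpha> mod h = \<beta> mod h" for \<alpha> \<beta>
    using that b_seq_cong[of h \<alpha> \<beta>] C_const_cong[OF \<open>h \<ge> 2\<close>, of \<alpha> \<beta>] h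
    by (simp add: R_def cong_def)
  have transform_desc: "fourier M (b_desc h u) = (\<lambda>r. gamma_desc h u * b_desc h (neg_inv h u) r)"
    if u: "u \<in> Units (residue_ring h)" for u
  proof -
    \<comment> \<open>The representative \<open>u\<close> is itself a lift, and its dual modulo \<open>2h\<close> lifts its dual modulo \<open>h\<close>.\<close>
    have lift: "u \<in> lifts h u"
      using lifts_eq[OF \<open>h \<ge> 2\<close> \<open>even h\<close> u] by simp
    then have unit: "u \<in> Units R" and "u mod h = u"
      by (simp_all add: lifts_def R_def)
    then have "neg_inv (2 * h) u \<in> lifts h (neg_inv h u)"
      using neg_inv_mod(2)[OF \<open>h \<ge> 2\<close>, of u] dual_unit by (simp add: lifts_def R_def)
    then show ?thesis
      using desc_eq[OF \<open>h \<ge> 2\<close> \<open>even h\<close> u lift] transform[OF unit]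
        desc_eq(1)[OF \<open>h \<ge> 2\<close> \<open>even h\<close> neg_inv_Units[OF h(2) u]]
      by simp
  qed
  have card_lifts: "card (lifts h u) = 2" if "u \<in> Units (residue_ring h)" for u
    using lifts_eq[OF \<open>h \<ge> 2\<close> \<open>even h\<close> that] h by simp
  show ?thesis
  proof (intro conjI ballI allI impI)
    fix \<alpha> assume \<alpha>: "\<alpha> \<in> Units R"
    show "C_rep h u U = C_const h \<alpha>"
      if "odd u \<and> [u = \<alpha>] (mod 2 * h) \<and> [U * u = 1] (mod 2 * h)" for u U
      using rep[OF \<alpha>] that by blast
    show "C_const h \<alpha> = fourier M (b_seq h \<alpha>) 1"
      unfolding M by (rule C[OF \<alpha>])
    show "neg_inv (2 * h) (neg_inv (2 * h) \<alpha>) = \<alpha>"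
      using \<alpha> unfolding R_def by (rule neg_inv_neg_inv[OF h(3)])
    show "neg_inv (2 * h) (\<alpha> \<oplus>\<^bsub>R\<^esub> h) = neg_inv (2 * h) \<alpha> \<oplus>\<^bsub>R\<^esub> h"
      using \<alpha> unfolding R_def by (rule neg_inv_add_half[OF \<open>h \<ge> 2\<close> \<open>even h\<close>])
    show "\<alpha> mod h \<in> Units (residue_ring h)" "neg_inv (2 * h) \<alpha> mod h = neg_inv h (\<alpha> mod h)"
      using \<alpha> unfolding R_def by (rule neg_inv_mod[OF \<open>h \<ge> 2\<close>])+
  next
    fix u assume u: "u \<in> Units (residue_ring h)"
    show "neg_inv h u \<in> Units (residue_ring h)" "neg_inv h (neg_inv h u) = u"
      using u by (rule neg_inv_Units[OF h(2)], rule neg_inv_neg_inv[OF h(2)])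
    show "b_desc h u = b_seq h \<alpha>" "gamma_desc h u = C_const h \<alpha>" if "\<alpha> \<in> lifts h u" for \<alpha>
      using u that by (rule desc_eq[OF \<open>h \<ge> 2\<close> \<open>even h\<close>])+
  qed (assumption | rule transform C_half norm_C sqrt_M mult_C card_lifts transform_desc
      descends[THEN conjunct1] descends[THEN conjunct2])+
qed

end
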